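(* Let $\alpha$ be a non-degenerate $(s+2t)$-simplex with vertices among the vertices of $\Pi^*_{s,t}$ and let $\sigma$ be an exterior face of $\alpha$. Then no two distinct exterior faces $\tau_1,\tau_2$ of $\alpha$ have both the same footprint and the same shadow with respect to $\sigma$; i.e. if $\sigma\cap\tau_1=\sigma\cap\tau_2$ and $\pi_\sigma(\tau_1)=\pi_\sigma(\tau_2)$, then $\tau_1=\tau_2$.
   Context: $\Pi^*_{s,t}$ is the product of $s$ copies of $\Delta^1$ and $t$ copies of $\Delta^2$ ($\Delta^d$ the $d$-simplex spanned by the standard unit vectors of $\mathbb{R}^{d+1}$), in standard coordinates with one block per factor; vertices are the $0/1$ points. Reduced coordinates w.r.t. a vertex $\mathbf v$: delete in each factor the coordinate where $\mathbf v$ is $1$. Class of the simplex: $|\det[\mathbf 1\mid M_{\mathbf v}]|$ with rows of $M_{\mathbf v}$ the reduced coordinates of its vertices; non-degenerate means class $\ne0$. An exterior $k$-face of $\alpha$ is a $k$-face of $\alpha$ whose $k+1$ vertices lie in a common $k$-dimensional face of $\Pi^*_{s,t}$. If $\sigma$ is an exterior $k$-face and $\mathbf v$ a vertex of $\sigma$, let $Z$ be the set of the $s+2t-k$ reduced coordinates (w.r.t. $\mathbf v$) that vanish at every vertex of $\sigma$, and let $\pi_\sigma$ be the linear projection (in reduced coordinates w.r.t. $\mathbf v$) that keeps the coordinates in $Z$ and sets all others to $0$. For a face $\tau$ of $\alpha$, its footprint with respect to $\sigma$ is $\sigma\cap\tau$ and its shadow with respect to $\sigma$ is $\pi_\sigma(\tau)$.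 *)

theory Defs
  imports "HOL-Analysis.Analysis" "Jordan_Normal_Form.Determinant"
begin

no_notation vec_index (infixl "$" 100)

text \<open>
  The standard coordinates are elements of a finite type \<open>'c\<close>. The block of the \<open>i\<close>-th factor is
  the set \<open>P i\<close> of its coordinates: the factors \<open>i < s\<close> are segments, the factors
  \<open>s \<le> i < s + t\<close> are triangles. The blocks need not exhaust \<open>'c\<close>; coordinates outside all blocks
  are 0 on the product. Since types are nonempty, this slack is what admits \<open>s = t = 0\<close>.
\<close>

definition block_structure :: "nat \<Rightarrow> nat \<Rightarrow> (nat \<Rightarrow> 'c::finite set) \<Rightarrow> bool" where
  "block_structure s t P \<longleftrightarrow>
     disjoint_family_on P {..<s + t} \<and>
     (\<forall>i<s. card (P i) = 2) \<and>
     (\<forall>i. s \<le> i \<and> i < s + t \<longrightarrow> card (P i) = 3)"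

definition coords :: "nat \<Rightarrow> nat \<Rightarrow> (nat \<Rightarrow> 'c::finite set) \<Rightarrow> 'c set" where
  "coords s t P = (\<Union>i<s + t. P i)"

definition keep :: "'c::finite set \<Rightarrow> real ^ 'c \<Rightarrow> real ^ 'c" where
  "keep Z x = (\<chi> c. if c \<in> Z then x $ c else 0)"

definition simplex_product :: "nat \<Rightarrow> nat \<Rightarrow> (nat \<Rightarrow> 'c::finite set) \<Rightarrow> (real ^ 'c) set" where
  "simplex_product s t P =
     {x. (\<forall>i<s + t. keep (P i) x \<in> convex hull ((\<lambda>c. axis c 1) ` P i)) \<and>
         keep (coords s t P) x = x}"

definition vertices :: "(real ^ 'c::finite) set \<Rightarrow> (real ^ 'c) set" where
  "vertices S = {x. x extreme_point_of S}"

definition reduced_coords ::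
  "nat \<Rightarrow> nat \<Rightarrow> (nat \<Rightarrow> 'c::finite set) \<Rightarrow> real ^ 'c \<Rightarrow> 'c set" where
  "reduced_coords s t P v = {c \<in> coords s t P. v $ c \<noteq> 1}"

text \<open>A vector of reduced coordinates is represented with the deleted coordinates set to 0.\<close>

definition reduced ::
  "nat \<Rightarrow> nat \<Rightarrow> (nat \<Rightarrow> 'c::finite set) \<Rightarrow> real ^ 'c \<Rightarrow> real ^ 'c \<Rightarrow> real ^ 'c" where
  "reduced s t P v x = keep (reduced_coords s t P v) x"

text \<open>
  The matrix \<open>[1 | M]\<close>, for a list \<open>xs\<close> of vertices (rows) and a list \<open>cs\<close> of the reduced
  coordinates (columns of \<open>M\<close>).
\<close>

definition class_matrix ::
  "nat \<Rightarrow> nat \<Rightarrow> (nat \<Rightarrow> 'c::finite set) \<Rightarrow> real ^ 'c \<Rightarrow> (real ^ 'c) list \<Rightarrow> 'c list \<Rightarrow> real mat" where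
  "class_matrix s t P v xs cs =
     mat (s + 2 * t + 1) (s + 2 * t + 1)
       (\<lambda>(i, j). if j = 0 then 1 else reduced s t P v (xs ! i) $ (cs ! (j - 1)))"

text \<open>
  Reordering rows or columns changes at most the sign of the determinant, so the choice of the
  two enumerations is immaterial.
\<close>

definition simplex_class ::
  "nat \<Rightarrow> nat \<Rightarrow> (nat \<Rightarrow> 'c::finite set) \<Rightarrow> real ^ 'c \<Rightarrow> (real ^ 'c) set \<Rightarrow> real" where
  "simplex_class s t P v V =
     \<bar>Determinant.det (class_matrix s t P v
        (SOME xs. distinct xs \<and> set xs = V)
        (SOME cs. distinct cs \<and> set cs = reduced_coords s t P v))\<bar>"

definition exterior_face ::
  "nat \<Rightarrow> nat \<Rightarrow> (nat \<Rightarrow> 'c::finite set) \<Rightarrow> (real ^ 'c) set \<Rightarrow> nat \<Rightarrow> (real ^ 'c) set \<Rightarrow> bool" where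
  "exterior_face s t P \<alpha> k F \<longleftrightarrow>
     F face_of \<alpha> \<and> aff_dim F = int k \<and>
     (\<exists>G. G face_of simplex_product s t P \<and> aff_dim G = int k \<and> vertices F \<subseteq> G)"

definition vanishing_coords ::
  "nat \<Rightarrow> nat \<Rightarrow> (nat \<Rightarrow> 'c::finite set) \<Rightarrow> real ^ 'c \<Rightarrow> (real ^ 'c) set \<Rightarrow> 'c set" where
  "vanishing_coords s t P v \<sigma> = {c \<in> reduced_coords s t P v. \<forall>x\<in>vertices \<sigma>. x $ c = 0}"

definition footprint :: "(real ^ 'c::finite) set \<Rightarrow> (real ^ 'c) set \<Rightarrow> (real ^ 'c) set" where
  "footprint \<sigma> \<tau> = \<sigma> \<inter> \<tau>"

definition shadow ::
  "nat \<Rightarrow> nat \<Rightarrow> (nat \<Rightarrow> 'c::finite set) \<Rightarrow> real ^ 'c \<Rightarrow> (real ^ 'c) set \<Rightarrow> (real ^ 'c) set \<Rightarrow> (real ^ 'c) set" where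
  "shadow s t P v \<sigma> \<tau> = (\<lambda>x. keep (vanishing_coords s t P v \<sigma>) (reduced s t P v x)) ` \<tau>"

end

theory Submission imports Defs begin

text \<open>
  Let \<open>G\<close> be the face of the product that contains \<open>\<sigma>\<close> and has the same dimension. Both have the
  same affine hull, and the kernel of \<open>\<pi>\<^sub>\<sigma>\<close> is the direction space of this hull: the barycentre
  of the vertices of \<open>\<sigma>\<close> is positive at every coordinate outside \<open>Z\<close>, so it can be moved both ways
  along any admissible direction that vanishes on \<open>Z\<close> without leaving the product, hence without
  leaving the face \<open>G\<close>. If now \<open>x\<close> is a vertex of \<open>\<tau>1\<close> outside \<open>\<sigma>\<close>, then \<open>\<pi>\<^sub>\<sigma> x = \<pi>\<^sub>\<sigma> y\<close> for some
  \<open>y\<close> in \<open>\<tau>2\<close>, so \<open>x\<close> is in the affine hull of \<open>\<sigma> \<union> \<tau>2\<close>. By affine independence of the vertices of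
  \<open>\<alpha>\<close>, it is a vertex of \<open>\<tau>2\<close>.
\<close>

lemma keep_nth [simp]: "keep Z x $ c = (if c \<in> Z then x $ c else 0)"
  by (simp add: keep_def)

text \<open>The unit vectors are linearly independent, so the weights of a convex combination of the
  \<open>axis c 1\<close> with \<open>c\<close> in \<open>A\<close> are its coordinates on
  \<open>A\<close> and can be read off.\<close>

lemma keep_in_hull_axis_iff:
  fixes A :: "'c::finite set"
  shows "keep A x \<in> convex hull ((\<lambda>c. axis c 1) ` A) \<longleftrightarrow>
    (\<forall>c\<in>A. 0 \<le> x $ c) \<and> (\<Sum>c\<in>A. x $ c) = (1::real)"
    (is "_ \<in> convex hull (?e ` A) \<longleftrightarrow> ?R")
proof -
  have inj: "inj_on ?e A"
    by (auto simp: inj_on_def axis_eq_axis)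
  have e_nth: "axis c (1::real) $ b = (if b = c then 1 else 0)" for b c :: 'c
    by (simp add: axis_def)
  have comb: "(\<Sum>z\<in>?e ` A. u z *\<^sub>R z) = keep A (\<chi> c. u (?e c))" for u :: "real ^ 'c \<Rightarrow> real"
  proof -
    have "(\<Sum>z\<in>?e ` A. u z *\<^sub>R z) = (\<Sum>c\<in>A. u (?e c) *\<^sub>R ?e c)"
      by (simp add: sum.reindex[OF inj])
    also have "\<dots> = keep A (\<chi> c. u (?e c))"
      by (simp add: Finite_Cartesian_Product.vec_eq_iff e_nth if_distrib cong: if_cong)
    finally show ?thesis .
  qed
  have "keep A x \<in> convex hull (?e ` A) \<longleftrightarrow>
      (\<exists>u. (\<forall>z\<in>?e ` A. 0 \<le> u z) \<and> sum u (?e ` A) = 1 \<and> (\<Sum>z\<in>?e ` A. u z *\<^sub>R z) = keep A x)"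
    by (simp add: convex_hull_finite)
  also have "\<dots> \<longleftrightarrow> ?R"
  proof
    assume "\<exists>u. (\<forall>z\<in>?e ` A. 0 \<le> u z) \<and> sum u (?e ` A) = 1 \<and> (\<Sum>z\<in>?e ` A. u z *\<^sub>R z) = keep A x"
    then obtain u where u: "\<forall>c\<in>A. 0 \<le> u (?e c)" "(\<Sum>c\<in>A. u (?e c)) = 1"
      and "keep A (\<chi> c. u (?e c)) = keep A x"
      unfolding comb by (auto simp: sum.reindex[OF inj])
    then have "\<forall>c\<in>A. u (?e c) = x $ c"
      by (auto simp: Finite_Cartesian_Product.vec_eq_iff split: if_splits)
    with u show ?R by simp
  next
    assume R: ?R
    \<comment> \<open>The weights of \<open>convex_hull_finite\<close> are indexed by points, so the
      coordinate of \<open>x\<close> is attached to its unit vector through the inverse of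
      \<open>axis\<close>.\<close>
    define u where "u z = x $ (the_inv_into A ?e z)" for z
    have u: "u (?e c) = x $ c" if "c \<in> A" for c
      using that by (simp add: u_def the_inv_into_f_f[OF inj])
    then have "keep A (\<chi> c. u (?e c)) = keep A x"
      by (auto simp: Finite_Cartesian_Product.vec_eq_iff)
    with R u show "\<exists>u. (\<forall>z\<in>?e ` A. 0 \<le> u z) \<and> sum u (?e ` A) = 1 \<and>
        (\<Sum>z\<in>?e ` A. u z *\<^sub>R z) = keep A x"
      unfolding comb by (intro exI[of _ u]) (simp add: sum.reindex[OF inj])
  qed
  finally show ?thesis .
qed

lemma mem_simplex_product_iff:
  "x \<in> simplex_product s t P \<longleftrightarrow>
    (\<forall>c\<in>coords s t P. 0 \<le> x $ c) \<and> (\<forall>i<s + t. (\<Sum>c\<in>P i. x $ c) = 1) \<and>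
    (\<forall>c. c \<notin> coords s t P \<longrightarrow> x $ c = 0)"
  by (auto simp: simplex_product_def keep_in_hull_axis_iff coords_def Finite_Cartesian_Product.vec_eq_iff)

lemma convex_simplex_product: "convex (simplex_product s t P)"
  by (rule convexI)
    (auto simp: mem_simplex_product_iff sum.distrib simp flip: sum_distrib_left)

text \<open>An affine dependence \<open>u\<close> is a nonzero vector in the left kernel of the
  class matrix: \<open>sum u V = 0\<close> kills the column of ones, and the vanishing weighted sum
  of the points kills every other column.\<close>

lemma affine_independent_if_simplex_class_nonzero:
  assumes card: "card V = s + 2 * t + 1" and nz: "simplex_class s t P w V \<noteq> 0"
  shows "\<not> affine_dependent V"
proof
  assume dep: "affine_dependent V"
  have "finite V"
    using card by (intro card_ge_0_finite) simp
  have "\<exists>u. sum u V = 0 \<and> (\<exists>v\<in>V. u v \<noteq> 0) \<and> (\<Sum>v\<in>V. u v *\<^sub>R v) = 0"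
    using dep by (rule affine_dependent_explicit_finite[OF \<open>finite V\<close>, THEN iffD1])
  then obtain u where u: "sum u V = 0" "\<exists>v\<in>V. u v \<noteq> 0" "(\<Sum>v\<in>V. u v *\<^sub>R v) = 0"
    by (elim exE conjE)
  \<comment> \<open>The same choices as in \<open>simplex_class\<close>, so that \<open>A\<close> is
    literally the matrix whose determinant is assumed nonzero.\<close>
  define xs where "xs = (SOME xs. distinct xs \<and> set xs = V)"
  define cs where "cs = (SOME cs. distinct cs \<and> set cs = reduced_coords s t P w)"
  define n where "n = s + 2 * t + 1"
  define A where "A = class_matrix s t P w xs cs"
  have "\<exists>xs. distinct xs \<and> set xs = V"
    using finite_distinct_list[OF \<open>finite V\<close>] by blast
  then have "distinct xs \<and> set xs = V"
    unfolding xs_def by (rule someI_ex)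
  then have xs: "distinct xs" "set xs = V" by auto
  have len: "length xs = n"
    using card xs distinct_card[OF xs(1)] by (simp add: n_def)
  have reindex: "(\<Sum>i<n. f (xs ! i)) = sum f V" for f :: "real ^ 'a \<Rightarrow> real"
    using xs len by (intro sum.reindex_bij_betw bij_betw_nth) auto
  have A: "A \<in> carrier_mat n n"
    by (simp add: A_def class_matrix_def n_def)
  have entry: "A $$ (i, j) = (if j = 0 then 1 else reduced s t P w (xs ! i) $ (cs ! (j - 1)))"
    if "i < n" "j < n" for i j
    using that by (simp add: A_def class_matrix_def n_def)
  define r where "r = vec n (\<lambda>i. u (xs ! i))"
  have "r \<noteq> 0\<^sub>v n"
  proof
    assume r0: "r = 0\<^sub>v n"
    obtain v where "v \<in> V" "u v \<noteq> 0" using u by blast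
    then obtain i where "i < n" "xs ! i = v"
      using xs len by (metis in_set_conv_nth)
    with r0 have "vec_index r i = 0" by simp
    with \<open>i < n\<close> \<open>xs ! i = v\<close> \<open>u v \<noteq> 0\<close> show False by (simp add: r_def)
  qed
  \<comment> \<open>The dependence is one between rows, while the determinant criterion speaks of a
    right kernel; hence the transpose.\<close>
  moreover have "transpose_mat A *\<^sub>v r = 0\<^sub>v n"
  proof (rule eq_vecI)
    fix j assume "j < dim_vec (0\<^sub>v n :: real Matrix.vec)"
    then have j: "j < n" by simp
    have "vec_index (transpose_mat A *\<^sub>v r) j = (\<Sum>i<n. A $$ (i, j) * u (xs ! i))"
      using j A by (simp add: scalar_prod_def r_def lessThan_atLeast0)
    also have "\<dots> = 0"
    proof (cases "j = 0")
      case True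
      then show ?thesis
        using u j by (simp add: entry reindex)
    next
      case False
      define c where "c = cs ! (j - 1)"
      have "(\<Sum>i<n. A $$ (i, j) * u (xs ! i)) = (\<Sum>i<n. reduced s t P w (xs ! i) $ c * u (xs ! i))"
        using False j by (simp add: entry c_def)
      also have "\<dots> = (\<Sum>x\<in>V. reduced s t P w x $ c * u x)"
        by (rule reindex)
      also have "\<dots> = reduced s t P w (\<Sum>x\<in>V. u x *\<^sub>R x) $ c"
        by (simp add: reduced_def mult.commute)
      also have "\<dots> = 0" using u by (simp add: reduced_def)
      finally show ?thesis .
    qed
    finally show "vec_index (transpose_mat A *\<^sub>v r) j = vec_index (0\<^sub>v n) j"
      using j by simp
  qed (use A in simp)
  moreover have "r \<in> carrier_vec n" by (simp add: r_def)
  ultimately have "Determinant.det (transpose_mat A) = 0"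
    using A det_0_iff_vec_prod_zero[of "transpose_mat A" n] by auto
  then have "Determinant.det A = 0"
    using A by (simp add: det_transpose)
  with nz show False
    by (simp add: simplex_class_def A_def xs_def cs_def)
qed

lemma vertices_convex_hull_affine_independent:
  assumes "\<not> affine_dependent S"
  shows "vertices (convex hull S) = S"
  using extreme_point_of_convex_hull_affine_independent[OF assms] by (auto simp: vertices_def)

text \<open>The two points obtained exhibit \<open>x - y\<close>, up to the factor \<open>e\<close>,
  as a difference of elements of the hull. In this form the direction can be added to a point of any
  larger affine hull.\<close>

lemma shift_mem_affine_hull_if_shadows_eq:
  fixes S :: "(real ^ 'c::finite) set"
  assumes fin: "finite S" and S: "vertices (convex hull S) = S"
    and G: "G face_of simplex_product s t P" "S \<subseteq> G" "aff_dim G = aff_dim S" and v: "v \<in> S"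
    and x: "x \<in> simplex_product s t P" and y: "y \<in> simplex_product s t P"
    and eq: "keep (vanishing_coords s t P v (convex hull S)) (reduced s t P v x) =
      keep (vanishing_coords s t P v (convex hull S)) (reduced s t P v y)"
  obtains m e where "m \<in> affine hull S" "e \<noteq> 0" "m + e *\<^sub>R (x - y) \<in> affine hull S"
proof -
  define Z where "Z = vanishing_coords s t P v (convex hull S)"
  define d where "d = x - y"
  define m where "m = (\<Sum>x\<in>S. (1 / card S) *\<^sub>R x)"
  have "card S > 0" using v fin by (auto simp: card_gt_0_iff)
  have mhull: "m \<in> convex hull S"
    unfolding m_def using \<open>card S > 0\<close> by (intro convex_sum fin) (auto simp: hull_inc)
  have SP: "S \<subseteq> simplex_product s t P"
    using G face_of_imp_subset by blast
  have mP: "m \<in> simplex_product s t P"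
    using mhull hull_minimal[of S "simplex_product s t P" convex] SP convex_simplex_product by blast
  have dZ: "d $ c = 0" if "c \<in> Z" for c
  proof -
    have "c \<in> reduced_coords s t P v" using that by (simp add: Z_def vanishing_coords_def)
    with that show ?thesis
      using arg_cong[OF eq, of "\<lambda>z. z $ c"] by (simp add: Z_def d_def reduced_def)
  qed
  \<comment> \<open>All weights of \<open>m\<close> are positive, so one vertex that is nonzero at
    \<open>c\<close> suffices. If \<open>c\<close> is deleted in the reduction, \<open>v\<close> is
    such a vertex; otherwise the definition of \<open>Z\<close> provides one.\<close>
  have mpos: "0 < m $ c" if c: "c \<in> coords s t P" "c \<notin> Z" for c
  proof -
    have "\<exists>z\<in>S. z $ c \<noteq> 0"
    proof (cases "v $ c = 1")
      case True
      then show ?thesis using v by (intro bexI[of _ v]) auto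
    next
      case False
      then show ?thesis
        using c by (auto simp: Z_def vanishing_coords_def reduced_coords_def S)
    qed
    then obtain z where "z \<in> S" "z $ c \<noteq> 0" by blast
    moreover have "\<forall>z\<in>S. 0 \<le> z $ c"
      using SP c by (auto simp: mem_simplex_product_iff)
    ultimately have "0 < (\<Sum>z\<in>S. z $ c)"
      using fin by (intro sum_pos2[of S z]) (auto simp: less_le)
    then show ?thesis
      using \<open>card S > 0\<close> by (simp add: m_def flip: sum_divide_distrib)
  qed
  have d_out: "d $ c = 0" if "c \<notin> coords s t P" for c
    using x y that by (simp add: d_def mem_simplex_product_iff)
  have d_sum: "(\<Sum>c\<in>P i. d $ c) = 0" if "i < s + t" for i
    using x y that by (simp add: d_def mem_simplex_product_iff sum_subtractf)
  \<comment> \<open>A single \<open>e\<close> must serve all coordinates; there are finitely many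
    strict inequalities, each true for small positive \<open>e\<close>.\<close>
  have "\<forall>\<^sub>F e in at_right 0. \<forall>c\<in>coords s t P - Z. e * \<bar>d $ c\<bar> < m $ c"
  proof (rule eventually_ball_finite)
    show "\<forall>c\<in>coords s t P - Z. \<forall>\<^sub>F e in at_right 0. e * \<bar>d $ c\<bar> < m $ c"
    proof
      fix c assume "c \<in> coords s t P - Z"
      then have "0 < m $ c" using mpos by blast
      moreover have "((\<lambda>e. e * \<bar>d $ c\<bar>) \<longlongrightarrow> 0 * \<bar>d $ c\<bar>) (at_right 0)"
        by (intro tendsto_intros)
      ultimately show "\<forall>\<^sub>F e in at_right 0. e * \<bar>d $ c\<bar> < m $ c"
        by (auto intro: order_tendstoD)
    qed
  qed simp
  then obtain e where e: "e > 0" "\<forall>c\<in>coords s t P - Z. e * \<bar>d $ c\<bar> < m $ c"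
    using eventually_happens[OF eventually_conj[OF _ eventually_at_right_less[of "0::real"]]] by force
  \<comment> \<open>Coordinates in \<open>Z\<close> stay fixed, the others have slack by the choice
    of \<open>e\<close>, and \<open>d\<close> sums to 0 over each block. Both signs of
    \<open>r\<close> are wanted, to make \<open>m\<close> a midpoint.\<close>
  have move: "m + r *\<^sub>R d \<in> simplex_product s t P" if r: "\<bar>r\<bar> = e" for r
    unfolding mem_simplex_product_iff
  proof (intro conjI ballI allI impI)
    fix c assume c: "c \<in> coords s t P"
    show "0 \<le> (m + r *\<^sub>R d) $ c"
    proof (cases "c \<in> Z")
      case True
      then show ?thesis using dZ mP c by (simp add: mem_simplex_product_iff)
    next
      case False
      have "- (r * d $ c) \<le> \<bar>r * d $ c\<bar>" by simp
      also have "\<dots> = e * \<bar>d $ c\<bar>" using r by (simp add: abs_mult)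
      also have "\<dots> < m $ c" using e False c by simp
      finally show ?thesis by simp
    qed
  next
    fix i assume "i < s + t"
    then show "(\<Sum>c\<in>P i. (m + r *\<^sub>R d) $ c) = 1"
      using d_sum mP by (simp add: mem_simplex_product_iff sum.distrib flip: sum_distrib_left)
  next
    fix c assume "c \<notin> coords s t P"
    then show "(m + r *\<^sub>R d) $ c = 0"
      using d_out mP by (simp add: mem_simplex_product_iff)
  qed
  have mG: "m \<in> G"
    using mhull hull_minimal[of S G convex] G face_of_imp_convex by blast
  \<comment> \<open>A face that meets an open segment of the product contains its endpoints. The
    open segment is empty when \<open>d = 0\<close>, so that case is separate.\<close>
  have mdG: "m + e *\<^sub>R d \<in> G"
  proof (cases "d = 0")
    case True
    then show ?thesis using mG by simp
  next
    case False
    have "m = midpoint (m - e *\<^sub>R d) (m + e *\<^sub>R d)"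
      by (simp add: midpoint_def flip: scaleR_2)
    moreover have "m - e *\<^sub>R d \<noteq> m + e *\<^sub>R d"
    proof
      assume "m - e *\<^sub>R d = m + e *\<^sub>R d"
      then have "(m + e *\<^sub>R d) - (m - e *\<^sub>R d) = 0" by (simp only: diff_self)
      moreover have "(m + e *\<^sub>R d) - (m - e *\<^sub>R d) = 2 *\<^sub>R (e *\<^sub>R d)"
        by (simp only: scaleR_2) simp
      ultimately have "2 = (0::real) \<or> e = 0 \<or> d = 0" by (simp only: scaleR_eq_0_iff)
      with False e show False by simp
    qed
    ultimately have "m \<in> open_segment (m - e *\<^sub>R d) (m + e *\<^sub>R d)"
      using midpoint_in_open_segment by metis
    then show ?thesis
      using face_ofD[OF G(1) _ _ _ mG, of "m - e *\<^sub>R d" "m + e *\<^sub>R d"] move[of e] move[of "- e"] e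
      by (simp add: mG)
  qed
  \<comment> \<open>Here the equal dimensions enter: the inclusion of \<open>S\<close> in
    \<open>G\<close> then forces equal affine hulls.\<close>
  have "affine hull S = affine hull G"
    using G by (metis aff_dim_eq_full_gen)
  then have "m \<in> affine hull S" "m + e *\<^sub>R (x - y) \<in> affine hull S"
    using mG mdG by (auto simp: hull_inc d_def)
  then show thesis using that[of m e] e by simp
qed

text \<open>Vertices in \<open>S\<close> are transferred by the footprint, the others by the shadow.
  One inclusion is enough, since the hypotheses are symmetric in \<open>W1\<close> and
  \<open>W2\<close>.\<close>

lemma vertices_subset_if_footprint_shadow_eq:
  fixes V S W1 W2 :: "(real ^ 'c::finite) set"
  assumes V: "V \<subseteq> simplex_product s t P" and ind: "\<not> affine_dependent V"
    and sub: "S \<subseteq> V" "W1 \<subseteq> V" "W2 \<subseteq> V"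
    and G: "G face_of simplex_product s t P" "S \<subseteq> G" "aff_dim G = aff_dim S"
    and v: "v \<in> S"
    and fp: "footprint (convex hull S) (convex hull W1) = footprint (convex hull S) (convex hull W2)"
    and sh: "shadow s t P v (convex hull S) (convex hull W1) =
      shadow s t P v (convex hull S) (convex hull W2)"
  shows "W1 \<subseteq> W2"
proof
  fix x assume xW: "x \<in> W1"
  have fin: "finite S"
    by (rule finite_subset[OF sub(1) aff_independent_finite[OF ind]])
  have S: "vertices (convex hull S) = S"
    by (rule vertices_convex_hull_affine_independent[OF affine_independent_subset[OF ind sub(1)]])
  have notin: "x \<notin> affine hull T" if "x \<notin> T" "T \<subseteq> V" for T
  proof
    assume "x \<in> affine hull T"
    moreover have "T \<subseteq> V - {x}" using that by blast
    ultimately have "x \<in> affine hull (V - {x})"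
      using hull_mono[of T "V - {x}" affine] by blast
    moreover have "x \<in> V" using xW sub by blast
    ultimately show False using ind unfolding affine_dependent_def by blast
  qed
  show "x \<in> W2"
  proof (cases "x \<in> S")
    case True
    then have "x \<in> footprint (convex hull S) (convex hull W1)"
      using xW unfolding footprint_def by (intro IntI hull_inc)
    then have "x \<in> convex hull W2"
      unfolding fp by (simp add: footprint_def)
    then show ?thesis
      using notin[of W2] sub convex_hull_subset_affine_hull[of W2] by blast
  next
    case False
    have "x \<in> convex hull W1" using xW by (rule hull_inc)
    then have "keep (vanishing_coords s t P v (convex hull S)) (reduced s t P v x)
        \<in> shadow s t P v (convex hull S) (convex hull W1)"
      unfolding shadow_def by (rule imageI)
    then have "keep (vanishing_coords s t P v (convex hull S)) (reduced s t P v x)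
        \<in> shadow s t P v (convex hull S) (convex hull W2)"
      unfolding sh .
    \<comment> \<open>The point \<open>y\<close> may lie anywhere in the hull of \<open>W2\<close>;
      it need not be a vertex.\<close>
    then obtain y where y: "y \<in> convex hull W2"
      and eq: "keep (vanishing_coords s t P v (convex hull S)) (reduced s t P v x) =
        keep (vanishing_coords s t P v (convex hull S)) (reduced s t P v y)"
      unfolding shadow_def by (elim imageE)
    have xP: "x \<in> simplex_product s t P" using xW sub V by blast
    have yP: "y \<in> simplex_product s t P"
      using y hull_minimal[of W2 "simplex_product s t P" convex] sub V convex_simplex_product by blast
    obtain m e where me: "m \<in> affine hull S" "e \<noteq> 0" "m + e *\<^sub>R (x - y) \<in> affine hull S"
      by (rule shift_mem_affine_hull_if_shadows_eq[OF fin S G v xP yP eq])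
    let ?H = "affine hull (S \<union> W2)"
    have "m \<in> ?H" "m + e *\<^sub>R (x - y) \<in> ?H"
      using me hull_mono[of S "S \<union> W2" affine] by blast+
    moreover have "y \<in> ?H"
      using y convex_hull_subset_affine_hull[of W2] hull_mono[of W2 "S \<union> W2" affine] by blast
    \<comment> \<open>Dividing the difference of the two points by \<open>e\<close> recovers
      \<open>x - y\<close>, and adding this to \<open>y\<close> gives \<open>x\<close> without
      leaving \<open>?H\<close>.\<close>
    ultimately have "y + (1 / e) *\<^sub>R ((m + e *\<^sub>R (x - y)) - m) \<in> ?H"
      using mem_affine_3_minus[OF affine_affine_hull] by blast
    moreover have "y + (1 / e) *\<^sub>R ((m + e *\<^sub>R (x - y)) - m) = x"
      using me(2) by (simp only: add_diff_cancel_left' scaleR_scaleR) simp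
    ultimately have "x \<in> ?H" by (simp only:)
    with notin[of "S \<union> W2"] sub False show ?thesis by blast
  qed
qed

theorem theorem9:
  fixes s t :: nat and P :: "nat \<Rightarrow> 'c::finite set"
    and V \<alpha> \<sigma> \<tau>1 \<tau>2 :: "(real ^ 'c) set" and v w :: "real ^ 'c" and k k1 k2 :: nat
  assumes "block_structure s t P"
    and "V \<subseteq> vertices (simplex_product s t P)"
    and "card V = s + 2 * t + 1"
    and "\<alpha> = convex hull V"
    and "w \<in> vertices (simplex_product s t P)"
    and "simplex_class s t P w V \<noteq> 0"
    and "exterior_face s t P \<alpha> k \<sigma>"
    and "v \<in> vertices \<sigma>"
    and "exterior_face s t P \<alpha> k1 \<tau>1"
    and "exterior_face s t P \<alpha> k2 \<tau>2"
    and "footprint \<sigma> \<tau>1 = footprint \<sigma> \<tau>2"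
    and "shadow s t P v \<sigma> \<tau>1 = shadow s t P v \<sigma> \<tau>2"
  shows "\<tau>1 = \<tau>2"

proof -
  have ind: "\<not> affine_dependent V"
    using assms by (intro affine_independent_if_simplex_class_nonzero)
  have V: "V \<subseteq> simplex_product s t P"
    using assms(2) by (auto simp: vertices_def extreme_point_of_def)
  \<comment> \<open>Faces of a simplex are hulls of sets of its vertices, so it remains to compare
    vertex sets.\<close>
  have face: "\<exists>W\<subseteq>V. F = convex hull W" if "exterior_face s t P \<alpha> j F" for j F
    using that face_of_convex_hull_affine_independent[OF ind] assms(4)
    by (auto simp: exterior_face_def)
  obtain S where S: "S \<subseteq> V" "\<sigma> = convex hull S" using face assms(7) by blast
  obtain W1 where W1: "W1 \<subseteq> V" "\<tau>1 = convex hull W1" using face assms(9) by blast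
  obtain W2 where W2: "W2 \<subseteq> V" "\<tau>2 = convex hull W2" using face assms(10) by blast
  have vS: "vertices \<sigma> = S"
    unfolding S(2)
    by (rule vertices_convex_hull_affine_independent[OF affine_independent_subset[OF ind S(1)]])
  obtain G where G: "G face_of simplex_product s t P" "S \<subseteq> G" "aff_dim G = aff_dim S"
    using assms(7) vS S(2) by (auto simp: exterior_face_def aff_dim_convex_hull)
  note subset = vertices_subset_if_footprint_shadow_eq[OF V ind S(1) _ _ G]
  have "W1 = W2"
    using subset[of W1 W2 v] subset[of W2 W1 v] assms(8,11,12) S W1 W2 vS by simp
  then show ?thesis using W1 W2 by simp
qed

end
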